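(* Let $\mathsf G=(\mathsf V,m,b,c)$ be a connected finite graph with standard edge weights $b\in\{0,1\}$, potential $c\equiv 0$ and vertex measure $m=\deg$, i.e. $m(\mathsf v)=\sum_{\mathsf w\in\mathsf V}b(\mathsf v,\mathsf w)$, and let $\emptyset\ne\mathsf V_0\subsetneq\mathsf V$. Then $$T_2(\mathsf G;\mathsf V_0)^{\frac23}\,\lambda_{0,2}(\mathsf G;\mathsf V_0)\ \ge\ 1 .$$ Moreover, equality holds if and only if $\mathsf G$ is (after identifying all vertices of $\mathsf V_0$ to a single vertex and discarding edges inside $\mathsf V_0$) a path graph on a single edge with one Dirichlet condition, that is, if and only if $\mathsf V\setminus\mathsf V_0$ consists of exactly one vertex and this vertex has degree $1$.
   Context: A finite graph $\mathsf G=(\mathsf V,m,b,c)$ consists of a finite set $\mathsf V$, a weight $m:\mathsf V\to(0,\infty)$, a symmetric function $b:\mathsf V\times\mathsf V\to[0,\infty)$ with $b(\mathsf v,\mathsf v)=0$, and $c:\mathsf V\to[0,\infty)$. Standard edge weights means that $b(\mathsf v,\mathsf w)\in\{0,1\}$ for all $\mathsf v,\mathsf w$. An edge is an unordered pair $\{\mathsf v,\mathsf w\}$ with $b(\mathsf v,\mathsf w)>0$; $\mathsf G$ is connected if any two vertices are joined by a sequence of vertices whose consecutive members have $b>0$. With $c\equiv0$ and Dirichlet conditions at $\mathsf V_0$, define (over $0\ne u:\mathsf V\to\mathbb R$ with $u=0$ on $\mathsf V_0$) $$T_2(\mathsf G;\mathsf V_0)=\sup_u\frac{\big(\sum_{\mathsf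 v}|u(\mathsf v)|m(\mathsf v)\big)^2}{\frac12\sum_{\mathsf v,\mathsf w}b(\mathsf v,\mathsf w)|u(\mathsf v)-u(\mathsf w)|^2},\qquad \lambda_{0,2}(\mathsf G;\mathsf V_0)=\inf_u\frac{\frac12\sum_{\mathsf v,\mathsf w}b(\mathsf v,\mathsf w)|u(\mathsf v)-u(\mathsf w)|^2}{\sum_{\mathsf v}|u(\mathsf v)|^2m(\mathsf v)}.$$ *)

theory Defs
  imports Complex_Main
begin

record 'a wgraph =
  verts :: "'a set"
  vmeas :: "'a \<Rightarrow> real"
  ewt :: "'a \<Rightarrow> 'a \<Rightarrow> real"
  pot :: "'a \<Rightarrow> real"

definition finite_graph :: "'a wgraph \<Rightarrow> bool" where
  "finite_graph G \<longleftrightarrow>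
     finite (verts G) \<and>
     (\<forall>v\<in>verts G. vmeas G v > 0) \<and>
     (\<forall>v\<in>verts G. \<forall>w\<in>verts G. ewt G v w \<ge> 0 \<and> ewt G v w = ewt G w v) \<and>
     (\<forall>v\<in>verts G. ewt G v v = 0) \<and>
     (\<forall>v\<in>verts G. pot G v \<ge> 0)"

definition standard_edge_weights :: "'a wgraph \<Rightarrow> bool" where
  "standard_edge_weights G \<longleftrightarrow> (\<forall>v\<in>verts G. \<forall>w\<in>verts G. ewt G v w \<in> {0, 1})"

definition adj_rel :: "'a wgraph \<Rightarrow> ('a \<times> 'a) set" where
  "adj_rel G = {(v, w). v \<in> verts G \<and> w \<in> verts G \<and> ewt G v w > 0}"

definition connected_graph :: "'a wgraph \<Rightarrow> bool" where
  "connected_graph G \<longleftrightarrow> (\<forall>v\<in>verts G. \<forall>w\<in>verts G. (v, w) \<in> (adj_rel G)\<^sup>*)"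

definition deg :: "'a wgraph \<Rightarrow> 'a \<Rightarrow> real" where
  "deg G v = (\<Sum>w\<in>verts G. ewt G v w)"

definition degree_measure :: "'a wgraph \<Rightarrow> bool" where
  "degree_measure G \<longleftrightarrow> (\<forall>v\<in>verts G. vmeas G v = deg G v)"

definition zero_potential :: "'a wgraph \<Rightarrow> bool" where
  "zero_potential G \<longleftrightarrow> (\<forall>v\<in>verts G. pot G v = 0)"

text \<open>Functions on the vertex set are represented by functions on the whole type; only their
  values on the vertex set matter, so being nonzero is required there.\<close>

definition dirichlet_functions :: "'a wgraph \<Rightarrow> 'a set \<Rightarrow> ('a \<Rightarrow> real) set" where
  "dirichlet_functions G V0 = {u. (\<forall>v\<in>V0. u v = 0) \<and> (\<exists>v\<in>verts G. u v \<noteq> 0)}"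

definition energy2 :: "'a wgraph \<Rightarrow> ('a \<Rightarrow> real) \<Rightarrow> real" where
  "energy2 G u = 1 / 2 * (\<Sum>v\<in>verts G. \<Sum>w\<in>verts G. ewt G v w * \<bar>u v - u w\<bar>\<^sup>2)"

text \<open>For a connected finite graph and a nonempty proper subset \<open>V0\<close> of its vertices, the energy
  is positive on all admissible functions, the two sets of quotients below are nonempty, and they
  are bounded above and below, respectively; so the real-valued supremum and infimum are the
  genuine ones.\<close>

definition T2 :: "'a wgraph \<Rightarrow> 'a set \<Rightarrow> real" where
  "T2 G V0 =
     (SUP u \<in> dirichlet_functions G V0. (\<Sum>v\<in>verts G. \<bar>u v\<bar> * vmeas G v)\<^sup>2 / energy2 G u)"

definition lambda02 :: "'a wgraph \<Rightarrow> 'a set \<Rightarrow> real" where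
  "lambda02 G V0 =
     (INF u \<in> dirichlet_functions G V0. energy2 G u / (\<Sum>v\<in>verts G. \<bar>u v\<bar>\<^sup>2 * vmeas G v))"

text \<open>Identification of all vertices of \<open>V0\<close> to the single vertex \<open>None\<close>: parallel edges arising
  from the identification add up, and edges inside \<open>V0\<close> are discarded.  The new graph again
  carries its own degree measure (this leaves the measure outside \<open>V0\<close> unchanged if the
  original graph carries the degree measure).\<close>

fun identified_ewt :: "'a wgraph \<Rightarrow> 'a set \<Rightarrow> 'a option \<Rightarrow> 'a option \<Rightarrow> real" where
  "identified_ewt G V0 (Some v) (Some w) = ewt G v w"
| "identified_ewt G V0 (Some v) None = (\<Sum>w\<in>V0. ewt G v w)"
| "identified_ewt G V0 None (Some w) = (\<Sum>v\<in>V0. ewt G v w)"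
| "identified_ewt G V0 None None = 0"

fun identified_pot :: "'a wgraph \<Rightarrow> 'a set \<Rightarrow> 'a option \<Rightarrow> real" where
  "identified_pot G V0 (Some v) = pot G v"
| "identified_pot G V0 None = (\<Sum>v\<in>V0. pot G v)"

definition identify :: "'a wgraph \<Rightarrow> 'a set \<Rightarrow> 'a option wgraph" where
  "identify G V0 =
     (let V' = insert None (Some ` (verts G - V0)) in
       \<lparr>verts = V',
        vmeas = (\<lambda>x. \<Sum>y\<in>V'. identified_ewt G V0 x y),
        ewt = identified_ewt G V0,
        pot = identified_pot G V0\<rparr>)"

definition single_edge_path_one_dirichlet :: "'a wgraph \<Rightarrow> 'a set \<Rightarrow> bool" where
  "single_edge_path_one_dirichlet G D \<longleftrightarrow>
     finite_graph G \<and> zero_potential G \<and> degree_measure G \<and>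
     (\<exists>x y. x \<noteq> y \<and> verts G = {x, y} \<and> ewt G x y = 1 \<and> D = {x})"

end

theory Submission
  imports Defs "HOL-Analysis.Analysis" "HOL-Library.Transitive_Closure_Table"
begin

text \<open>Write \<open>A\<close>, \<open>S\<close> and \<open>E\<close> for the weighted \<open>\<ell>\<^sup>1\<close>-norm, the squared weighted \<open>\<ell>\<^sup>2\<close>-norm and the
  energy of a Dirichlet function \<open>f\<close> with \<open>0 \<le> f \<le> 1\<close> and \<open>max f = 1\<close>. Everything rests on the
  Nash-type inequality \<open>S\<^sup>3 \<le> A\<^sup>4 E\<close>, since \<open>T\<^sub>2 \<ge> A\<^sup>2 / E\<close> for every \<open>f\<close>, while
  \<open>\<lambda> = E / S\<close> for a minimiser \<open>f\<close>.

  For \<open>\<phi>(t) = 2t\<^sup>2 - t\<^sup>3\<close>, the Cauchy-Schwarz inequality and the pointwise bound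
  \<open>(\<phi>(a) - \<phi>(b))\<^sup>2 \<le> (a - b)\<^sup>2 (4a - 3a\<^sup>2 + 4b - 3b\<^sup>2)\<close> on the unit square estimate the squared total
  variation of \<open>\<phi> \<circ> f\<close>, which is at least 1 by connectedness, by \<open>E (4A - 3S)\<close>. The Nash inequality
  then follows from \<open>A\<^sup>4 - 4AS\<^sup>3 + 3S\<^sup>4 = (A - S)\<^sup>2 (A\<^sup>2 + 2AS + 3S\<^sup>2) \<ge> 0\<close>.

  If equality holds, then \<open>A = S\<close>, so \<open>f\<close> is an indicator function, whose energy equals its total
  variation and hence is at least 1; this forces \<open>A = E = 1\<close> and \<open>T\<^sub>2 = 1\<close>. Testing \<open>T\<^sub>2\<close> with the
  indicator function of the complement of \<open>V0\<close> shows that this complement has measure at most 1.\<close>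

section \<open>Total variation along a path\<close>

text \<open>The double sum meets every edge of the path in both orientations, hence the factor 2;
  distinctness of the vertices keeps these terms from coinciding.\<close>

lemma simple_path_variation:
  fixes h :: "'a \<Rightarrow> 'a \<Rightarrow> real" and g :: "'a \<Rightarrow> real"
  assumes "rtrancl_path r x xs y" and "distinct (x # xs)"
    and nonneg: "\<And>v w. 0 \<le> h v w"
    and edge: "\<And>v w. r v w \<Longrightarrow> g v - g w \<le> h v w" "\<And>v w. r v w \<Longrightarrow> g v - g w \<le> h w v"
  shows "2 * (g x - g y) \<le> (\<Sum>v\<in>set (x # xs). \<Sum>w\<in>set (x # xs). h v w)"
  using assms(1,2)
proof (induction rule: rtrancl_path.induct)
  case (base x)
  then show ?case using nonneg[of x x] by simp
next
  case (step x y ys z)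
  define X where "X = set (y # ys)"
  have X: "finite X" "x \<notin> X" "y \<in> X" using step.prems by (auto simp: X_def)
  \<comment> \<open>The row and the column of \<open>x\<close> each supply one copy of the first
    edge.\<close>
  have "h x y \<le> (\<Sum>w\<in>X. h x w)" "h y x \<le> (\<Sum>w\<in>X. h w x)"
    using X nonneg by (auto intro: member_le_sum)
  moreover have "2 * (g y - g z) \<le> (\<Sum>v\<in>X. \<Sum>w\<in>X. h v w)"
    using step.IH step.prems by (simp add: X_def)
  ultimately have "2 * (g x - g z)
      \<le> h x x + (\<Sum>w\<in>X. h x w) + (\<Sum>w\<in>X. h w x) + (\<Sum>v\<in>X. \<Sum>w\<in>X. h v w)"
    using edge(1)[OF step.hyps(1)] edge(2)[OF step.hyps(1)] nonneg[of x x] by argo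
  also have "\<dots> = (\<Sum>v\<in>insert x X. \<Sum>w\<in>insert x X. h v w)"
    using X by (simp add: sum.distrib)
  finally have "2 * (g x - g z) \<le> (\<Sum>v\<in>insert x X. \<Sum>w\<in>insert x X. h v w)" .
  then show ?case by (simp add: X_def)
qed

lemma rtrancl_path_subset:
  assumes "rtrancl_path r x xs y" and "\<And>v w. r v w \<Longrightarrow> w \<in> V"
  shows "set xs \<subseteq> V"
  using assms by (induction rule: rtrancl_path.induct) auto

section \<open>Two polynomial inequalities\<close>

text \<open>With \<open>y\<close> as in the proof, the left side is
  \<open>((a - b) * y)\<^sup>2\<close> and the last factor on the right is
  \<open>2 * y - (a - b)\<^sup>2\<close>. For \<open>b \<le> a\<close> it therefore suffices that
  \<open>a - b\<close> is at most \<open>y\<close> and at most \<open>2 - y\<close>.\<close>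

lemma cubic_difference_bound:
  fixes a b :: real
  assumes "0 \<le> a" "a \<le> 1" "0 \<le> b" "b \<le> 1"
  shows "((2 * a\<^sup>2 - a ^ 3) - (2 * b\<^sup>2 - b ^ 3))\<^sup>2
    \<le> (a - b)\<^sup>2 * ((4 * a - 3 * a\<^sup>2) + (4 * b - 3 * b\<^sup>2))"
  using assms
proof (induction a b rule: linorder_wlog)
  case (sym a b)
  then show ?case by (simp add: power2_commute algebra_simps)
next
  case (le b a)
  define y where "y = 2 * (a + b) - (a\<^sup>2 + a * b + b\<^sup>2)"
  have "y - (a - b) = a * (1 - a) + b * (1 - a) + b * (1 - b) + b"
    by (simp add: y_def algebra_simps power2_eq_square)
  moreover have "\<dots> \<ge> 0" using le by (intro add_nonneg_nonneg mult_nonneg_nonneg) auto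
  ultimately have 1: "a - b \<le> y" by linarith
  have "2 - y - (a - b) = b\<^sup>2 + (1 - a)\<^sup>2 + (1 - a) * (1 - b)"
    by (simp add: y_def algebra_simps power2_eq_square)
  moreover have "\<dots> \<ge> 0" using le by (intro add_nonneg_nonneg mult_nonneg_nonneg) auto
  ultimately have 2: "a - b \<le> 2 - y" by linarith
  have "(a - b) * (a - b) \<le> y * (2 - y)"
    using 1 2 le by (intro mult_mono) auto
  then have "y\<^sup>2 \<le> 2 * y - (a - b)\<^sup>2" by (simp add: power2_eq_square algebra_simps)
  also have "\<dots> = (4 * a - 3 * a\<^sup>2) + (4 * b - 3 * b\<^sup>2)"
    by (simp add: y_def power2_eq_square algebra_simps)
  finally have "(a - b)\<^sup>2 * y\<^sup>2 \<le> (a - b)\<^sup>2 * ((4 * a - 3 * a\<^sup>2) + (4 * b - 3 * b\<^sup>2))"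
    by (intro mult_left_mono) auto
  moreover have "(2 * a\<^sup>2 - a ^ 3) - (2 * b\<^sup>2 - b ^ 3) = (a - b) * y"
    by (simp add: y_def power2_eq_square power3_eq_cube algebra_simps)
  \<comment> \<open>In this case \<open>b \<le> a\<close> and the goal has the two variables
    exchanged, which changes the sign.\<close>
  moreover have "(2 * b\<^sup>2 - b ^ 3) - (2 * a\<^sup>2 - a ^ 3) = - ((a - b) * y)"
    using calculation(2) by linarith
  ultimately show ?case
    by (simp only: power2_minus power_mult_distrib power2_commute[of b a] add.commute)
qed

lemma quartic_factorisation:
  fixes A S :: real
  shows "A ^ 4 - S ^ 3 * (4 * A - 3 * S) = (A - S)\<^sup>2 * (A\<^sup>2 + 2 * A * S + 3 * S\<^sup>2)"
  by (simp add: power2_eq_square power3_eq_cube power4_eq_xxxx algebra_simps)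

section \<open>The Nash-type inequality\<close>

locale dirichlet_graph =
  fixes G :: "'a wgraph" and V0 :: "'a set"
  assumes graph: "finite_graph G"
    and conn: "connected_graph G"
    and std: "standard_edge_weights G"
    and deg_meas: "degree_measure G"
    and V0_ne: "V0 \<noteq> {}"
    and V0_sub: "V0 \<subset> verts G"
begin

abbreviation "V \<equiv> verts G"
abbreviation "b \<equiv> ewt G"
abbreviation "m \<equiv> vmeas G"

definition l1 :: "('a \<Rightarrow> real) \<Rightarrow> real" where
  "l1 u = (\<Sum>v\<in>V. \<bar>u v\<bar> * m v)"

definition l2 :: "('a \<Rightarrow> real) \<Rightarrow> real" where
  "l2 u = (\<Sum>v\<in>V. \<bar>u v\<bar>\<^sup>2 * m v)"

text \<open>Vanishing is imposed on the whole type outside \<open>V - V0\<close>, so that the set is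
  compact in the product topology.\<close>

definition unit_functions :: "('a \<Rightarrow> real) set" where
  "unit_functions = {f. (\<forall>x. 0 \<le> f x \<and> f x \<le> 1) \<and> (\<forall>x. x \<notin> V - V0 \<longrightarrow> f x = 0) \<and>
     (\<exists>v\<in>V - V0. f v = 1)}"

section \<open>Edge weights, degree measure and total variation\<close>

lemma fin [simp]: "finite V"
  and m_pos: "v \<in> V \<Longrightarrow> 0 < m v"
  and b_nonneg: "v \<in> V \<Longrightarrow> w \<in> V \<Longrightarrow> 0 \<le> b v w"
  and b_sym: "v \<in> V \<Longrightarrow> w \<in> V \<Longrightarrow> b v w = b w v"
  and b_loop: "v \<in> V \<Longrightarrow> b v v = 0"
  using graph by (auto simp: finite_graph_def)

lemma b_pos: "v \<in> V \<Longrightarrow> w \<in> V \<Longrightarrow> 0 < b v w \<Longrightarrow> b v w = 1"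
  using std by (force simp: standard_edge_weights_def)

lemma m_eq: "v \<in> V \<Longrightarrow> m v = (\<Sum>w\<in>V. b v w)"
  using deg_meas by (simp add: degree_measure_def deg_def)

text \<open>A positive degree forces an incident edge, and edges have weight 1.\<close>

lemma m_ge_1:
  assumes "v \<in> V"
  shows "1 \<le> m v"
proof -
  obtain w where w: "w \<in> V" "b v w \<noteq> 0"
    using m_pos[OF assms] m_eq[OF assms] by (metis less_irrefl sum.neutral)
  then have "b v w = 1" using b_pos b_nonneg assms by (metis order_le_less)
  moreover have "b v w \<le> m v"
    unfolding m_eq[OF assms] using w b_nonneg[OF assms] by (auto intro: member_le_sum)
  ultimately show ?thesis by simp
qed

lemma total_variation_ge:
  fixes g :: "'a \<Rightarrow> real"
  assumes "x \<in> V" "y \<in> V"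
  shows "2 * (g x - g y) \<le> (\<Sum>v\<in>V. \<Sum>w\<in>V. b v w * \<bar>g v - g w\<bar>)"
proof -
  define r where "r = (\<lambda>v w. (v, w) \<in> adj_rel G)"
  have r: "v \<in> V \<and> w \<in> V \<and> b v w = 1 \<and> b w v = 1" if "r v w" for v w
    using that b_pos b_sym by (force simp: r_def adj_rel_def)
  \<comment> \<open>Extension by zero makes \<open>h\<close> nonnegative everywhere, whereas
    \<open>b\<close> is controlled only on \<open>V\<close>.\<close>
  define h where "h v w = (if v \<in> V \<and> w \<in> V then b v w * \<bar>g v - g w\<bar> else 0)" for v w
  have h: "0 \<le> h v w" for v w by (simp add: h_def b_nonneg)
  have "(x, y) \<in> (adj_rel G)\<^sup>*" using conn assms by (simp add: connected_graph_def)
  then have "r\<^sup>*\<^sup>* x y" by (simp add: r_def rtranclp_rtrancl_eq)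
  then obtain zs where "rtrancl_path r x zs y" by (auto simp: rtranclp_eq_rtrancl_path)
  then obtain xs where xs: "rtrancl_path r x xs y" "distinct (x # xs)"
    by (rule rtrancl_path_distinct)
  have sub: "set (x # xs) \<subseteq> V" using rtrancl_path_subset[OF xs(1), of V] r assms by auto
  have "2 * (g x - g y) \<le> (\<Sum>v\<in>set (x # xs). \<Sum>w\<in>set (x # xs). h v w)"
    by (rule simple_path_variation[OF xs h]) (use r in \<open>auto simp: h_def\<close>)
  also have "\<dots> \<le> (\<Sum>v\<in>set (x # xs). \<Sum>w\<in>V. h v w)"
    using sub h by (intro sum_mono sum_mono2) auto
  also have "\<dots> \<le> (\<Sum>v\<in>V. \<Sum>w\<in>V. h v w)"
    using sub h by (intro sum_mono2 sum_nonneg) auto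
  also have "\<dots> = (\<Sum>v\<in>V. \<Sum>w\<in>V. b v w * \<bar>g v - g w\<bar>)"
    by (intro sum.cong) (auto simp: h_def)
  finally show ?thesis .
qed

text \<open>By symmetry of \<open>b\<close> both endpoints contribute equally, and its row sums are
  \<open>m\<close>; thus \<open>m = deg\<close> turns edge sums into vertex sums.\<close>

lemma sum_edges_eq:
  fixes p :: "'a \<Rightarrow> real"
  shows "(\<Sum>v\<in>V. \<Sum>w\<in>V. b v w * (p v + p w)) = 2 * (\<Sum>v\<in>V. p v * m v)"
proof -
  have "(\<Sum>v\<in>V. \<Sum>w\<in>V. b v w * p w) = (\<Sum>w\<in>V. \<Sum>v\<in>V. b v w * p w)"
    by (rule sum.swap)
  also have "\<dots> = (\<Sum>w\<in>V. \<Sum>v\<in>V. b w v * p w)"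
    by (intro sum.cong) (auto simp: b_sym)
  finally show ?thesis
    by (simp add: m_eq distrib_left sum.distrib sum_distrib_left mult.commute)
qed

section \<open>Energy estimates for normalised functions\<close>

lemma energy_nonneg: "0 \<le> energy2 G u"
  unfolding energy2_def by (intro mult_nonneg_nonneg sum_nonneg) (auto simp: b_nonneg)

lemma unit_functionsD:
  assumes "f \<in> unit_functions"
  shows "0 \<le> f x" "f x \<le> 1" "x \<notin> V - V0 \<Longrightarrow> f x = 0"
  using assms by (auto simp: unit_functions_def)

text \<open>The values 1 and 0 are both attained, the latter on \<open>V0\<close>. The function
  \<phi> is general because the equality case uses the identity instead of the cubic.\<close>

lemma unit_variation_ge:
  fixes \<phi> :: "real \<Rightarrow> real"
  assumes "f \<in> unit_functions"
  shows "2 * (\<phi> 1 - \<phi> 0) \<le> (\<Sum>v\<in>V. \<Sum>w\<in>V. b v w * \<bar>\<phi> (f v) - \<phi> (f w)\<bar>)"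
proof -
  obtain v where v: "v \<in> V - V0" "f v = 1" using assms by (auto simp: unit_functions_def)
  obtain w where w: "w \<in> V0" using V0_ne by auto
  have "f w = 0" using unit_functionsD(3)[OF assms] w by simp
  then show ?thesis using total_variation_ge[of v w "\<lambda>x. \<phi> (f x)"] v w V0_sub by auto
qed

lemma energy_mult_ge_1:
  assumes f: "f \<in> unit_functions"
  shows "1 \<le> energy2 G f * (4 * l1 f - 3 * l2 f)"
proof -
  define \<phi> :: "real \<Rightarrow> real" where "\<phi> t = 2 * t\<^sup>2 - t ^ 3" for t
  define p :: "'a \<Rightarrow> real" where "p v = 4 * f v - 3 * (f v)\<^sup>2" for v
  let ?VV = "V \<times> V"
  have p: "0 \<le> p v" for v
  proof -
    have "f v * f v \<le> f v" using unit_functionsD[OF f] by (intro mult_left_le) auto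
    then show ?thesis using unit_functionsD[OF f, of v] by (simp add: p_def power2_eq_square)
  qed
  \<comment> \<open>Splitting \<open>b\<close> into two square roots prepares Cauchy-Schwarz: the
    first factors produce the energy, the second ones the sum of \<open>p\<close>.\<close>
  have edge: "b v w * \<bar>\<phi> (f v) - \<phi> (f w)\<bar>
      \<le> (sqrt (b v w) * \<bar>f v - f w\<bar>) * (sqrt (b v w) * sqrt (p v + p w))"
    if "v \<in> V" "w \<in> V" for v w
  proof -
    have "\<bar>\<phi> (f v) - \<phi> (f w)\<bar> = sqrt ((\<phi> (f v) - \<phi> (f w))\<^sup>2)" by simp
    also have "\<dots> \<le> sqrt ((f v - f w)\<^sup>2 * (p v + p w))"
      unfolding \<phi>_def p_def
      by (intro real_sqrt_le_mono cubic_difference_bound) (auto simp: unit_functionsD[OF f])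
    also have "\<dots> = \<bar>f v - f w\<bar> * sqrt (p v + p w)" by (simp add: real_sqrt_mult)
    finally have "b v w * \<bar>\<phi> (f v) - \<phi> (f w)\<bar> \<le> b v w * (\<bar>f v - f w\<bar> * sqrt (p v + p w))"
      using b_nonneg[OF that] by (rule mult_left_mono)
    also have "\<dots> = (sqrt (b v w) * sqrt (b v w)) * (\<bar>f v - f w\<bar> * sqrt (p v + p w))"
      using b_nonneg[OF that] by simp
    finally show ?thesis by (simp only: mult_ac)
  qed
  have "2 \<le> (\<Sum>v\<in>V. \<Sum>w\<in>V. b v w * \<bar>\<phi> (f v) - \<phi> (f w)\<bar>)"
    using unit_variation_ge[OF f, of \<phi>] by (simp add: \<phi>_def)
  also have "\<dots> = (\<Sum>(v,w)\<in>?VV. b v w * \<bar>\<phi> (f v) - \<phi> (f w)\<bar>)"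
    by (simp add: sum.cartesian_product)
  also have "\<dots> \<le> (\<Sum>x\<in>?VV. (sqrt (b (fst x) (snd x)) * \<bar>f (fst x) - f (snd x)\<bar>)
      * (sqrt (b (fst x) (snd x)) * sqrt (p (fst x) + p (snd x))))" (is "_ \<le> ?C")
    using edge by (intro sum_mono) auto
  \<comment> \<open>Both sums of squares run over ordered pairs, and their factors 2 cancel
    \<open>2\<^sup>2\<close>.\<close>
  finally have "2\<^sup>2 \<le> ?C\<^sup>2" by (intro power_mono) auto
  also have "\<dots> \<le> (\<Sum>x\<in>?VV. (sqrt (b (fst x) (snd x)) * \<bar>f (fst x) - f (snd x)\<bar>)\<^sup>2)
      * (\<Sum>x\<in>?VV. (sqrt (b (fst x) (snd x)) * sqrt (p (fst x) + p (snd x)))\<^sup>2)"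
    by (rule Cauchy_Schwarz_ineq_sum)
  also have "(\<Sum>x\<in>?VV. (sqrt (b (fst x) (snd x)) * \<bar>f (fst x) - f (snd x)\<bar>)\<^sup>2) = 2 * energy2 G f"
    unfolding energy2_def sum.cartesian_product
    by (auto intro!: sum.cong simp: power_mult_distrib b_nonneg)
  also have "(\<Sum>x\<in>?VV. (sqrt (b (fst x) (snd x)) * sqrt (p (fst x) + p (snd x)))\<^sup>2)
      = (\<Sum>v\<in>V. \<Sum>w\<in>V. b v w * (p v + p w))"
    unfolding sum.cartesian_product
    by (auto intro!: sum.cong simp: power_mult_distrib b_nonneg p)
  also have "\<dots> = 2 * (\<Sum>v\<in>V. p v * m v)" by (rule sum_edges_eq)
  also have "(\<Sum>v\<in>V. p v * m v) = 4 * l1 f - 3 * l2 f"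
    by (simp add: l1_def l2_def p_def sum_distrib_left left_diff_distrib sum_subtractf
        unit_functionsD[OF f] mult.assoc)
  finally show ?thesis by (simp add: algebra_simps)
qed

lemma l1_ge_1:
  assumes f: "f \<in> unit_functions"
  shows "1 \<le> l1 f"
proof -
  obtain v where v: "v \<in> V" "f v = 1" using f by (auto simp: unit_functions_def)
  have "\<bar>f v\<bar> * m v \<le> l1 f"
    unfolding l1_def using v m_pos by (intro member_le_sum) (auto simp: less_imp_le)
  then show ?thesis using m_ge_1[OF v(1)] v by simp
qed

lemma l2_pos:
  assumes f: "f \<in> unit_functions"
  shows "0 < l2 f"
proof -
  obtain v where v: "v \<in> V" "f v = 1" using f by (auto simp: unit_functions_def)
  have "\<bar>f v\<bar>\<^sup>2 * m v \<le> l2 f"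
    unfolding l2_def using v m_pos by (intro member_le_sum) (auto simp: less_imp_le)
  then show ?thesis using m_pos[OF v(1)] v by simp
qed

lemma energy_pos:
  assumes f: "f \<in> unit_functions"
  shows "0 < energy2 G f"
  using energy_mult_ge_1[OF f] energy_nonneg[of f]
  by (metis mult_zero_left not_one_le_zero order_le_less)

lemma nash:
  assumes f: "f \<in> unit_functions"
  shows "l2 f ^ 3 \<le> l1 f ^ 4 * energy2 G f"
    and "l2 f ^ 3 = l1 f ^ 4 * energy2 G f \<Longrightarrow> l1 f = l2 f"
proof -
  let ?A = "l1 f" and ?S = "l2 f" and ?E = "energy2 G f"
  note pos = l1_ge_1[OF f] l2_pos[OF f] energy_pos[OF f]
  have Q: "0 < ?A\<^sup>2 + 2 * ?A * ?S + 3 * ?S\<^sup>2" using pos by (intro add_pos_pos) auto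
  have le: "?S ^ 3 * (4 * ?A - 3 * ?S) \<le> ?A ^ 4"
    using quartic_factorisation[of ?A ?S] Q
    by (metis diff_ge_0_iff_ge mult_nonneg_nonneg less_imp_le zero_le_power2)
  have "?S ^ 3 \<le> ?S ^ 3 * (?E * (4 * ?A - 3 * ?S))"
    using mult_left_mono[OF energy_mult_ge_1[OF f], of "?S ^ 3"] pos by simp
  also have "\<dots> = (?S ^ 3 * (4 * ?A - 3 * ?S)) * ?E" by simp
  finally have 1: "?S ^ 3 \<le> (?S ^ 3 * (4 * ?A - 3 * ?S)) * ?E" .
  also have "\<dots> \<le> ?A ^ 4 * ?E" using le pos by (intro mult_right_mono) auto
  finally show "?S ^ 3 \<le> ?A ^ 4 * ?E" .
  \<comment> \<open>Cancelling the positive energy, equality forces the factorised quartic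
    difference to vanish.\<close>
  assume "?S ^ 3 = ?A ^ 4 * ?E"
  with 1 have "?A ^ 4 \<le> ?S ^ 3 * (4 * ?A - 3 * ?S)"
    using pos mult_le_cancel_right_pos by metis
  with le have "(?A - ?S)\<^sup>2 * (?A\<^sup>2 + 2 * ?A * ?S + 3 * ?S\<^sup>2) = 0"
    using quartic_factorisation[of ?A ?S] by linarith
  then show "?A = ?S" using Q by auto
qed

section \<open>Reduction to normalised functions and existence of a minimiser\<close>

lemma unit_functions_dirichlet: "f \<in> unit_functions \<Longrightarrow> f \<in> dirichlet_functions G V0"
  unfolding unit_functions_def dirichlet_functions_def by force

text \<open>Take \<open>f\<close> as the absolute value of \<open>u\<close> divided by its maximum:
  this only rescales both norms, absolute values do not increase the energy, and the quotients are
  scale invariant.\<close>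

lemma normalise:
  assumes u: "u \<in> dirichlet_functions G V0"
  obtains f where "f \<in> unit_functions"
    and "(l1 u)\<^sup>2 / energy2 G u \<le> (l1 f)\<^sup>2 / energy2 G f"
    and "energy2 G f / l2 f \<le> energy2 G u / l2 u"
proof -
  define c where "c = Max ((\<lambda>v. \<bar>u v\<bar>) ` V)"
  obtain z where z: "z \<in> V" "u z \<noteq> 0" using u by (auto simp: dirichlet_functions_def)
  then have ne: "(\<lambda>v. \<bar>u v\<bar>) ` V \<noteq> {}" by auto
  have c_ge: "\<bar>u v\<bar> \<le> c" if "v \<in> V" for v using that by (simp add: c_def)
  have c: "0 < c" using c_ge[OF z(1)] z(2) by linarith
  obtain v where v: "v \<in> V" "\<bar>u v\<bar> = c"
    using Max_in[OF _ ne] by (auto simp: c_def)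
  define f where "f x = (if x \<in> V - V0 then \<bar>u x\<bar> / c else 0)" for x
  have u0: "u x = 0" if "x \<in> V0" for x using u that by (auto simp: dirichlet_functions_def)
  have cf: "\<bar>u x\<bar> = c * f x" if "x \<in> V" for x using that c u0 by (auto simp: f_def)
  have f: "f \<in> unit_functions"
    unfolding unit_functions_def
    using c c_ge v u0 by (auto simp: f_def intro!: bexI[of _ v])
  have f_abs: "\<bar>f x\<bar> = f x" for x using unit_functionsD[OF f] by simp
  have A: "l1 u = c * l1 f"
    unfolding l1_def sum_distrib_left f_abs by (intro sum.cong) (auto simp: cf)
  have S: "l2 u = c\<^sup>2 * l2 f"
    unfolding l2_def sum_distrib_left f_abs
    by (intro sum.cong refl, subst cf) (auto simp: power_mult_distrib)
  have "c\<^sup>2 * (b x y * \<bar>f x - f y\<bar>\<^sup>2) \<le> b x y * \<bar>u x - u y\<bar>\<^sup>2" if "x \<in> V" "y \<in> V" for x y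
  proof -
    have "c\<^sup>2 * \<bar>f x - f y\<bar>\<^sup>2 = \<bar>\<bar>u x\<bar> - \<bar>u y\<bar>\<bar>\<^sup>2"
      using that by (simp add: cf power_mult_distrib[symmetric] right_diff_distrib)
    also have "\<dots> \<le> \<bar>u x - u y\<bar>\<^sup>2" by (intro power_mono) auto
    finally show ?thesis
      using mult_left_mono[OF _ b_nonneg[OF that]] by (metis mult.left_commute)
  qed
  then have E: "c\<^sup>2 * energy2 G f \<le> energy2 G u"
    unfolding energy2_def by (simp add: sum_distrib_left) (intro sum_mono divide_right_mono; simp)
  note pos = energy_pos[OF f] l2_pos[OF f]
  have cE: "0 < c\<^sup>2 * energy2 G f" using c pos by simp
  have "(l1 u)\<^sup>2 / energy2 G u \<le> (l1 u)\<^sup>2 / (c\<^sup>2 * energy2 G f)"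
    using E cE by (intro divide_left_mono) auto
  also have "\<dots> = (l1 f)\<^sup>2 / energy2 G f" using c by (simp add: A power_mult_distrib)
  finally have 1: "(l1 u)\<^sup>2 / energy2 G u \<le> (l1 f)\<^sup>2 / energy2 G f" .
  have "energy2 G f / l2 f = (c\<^sup>2 * energy2 G f) / (c\<^sup>2 * l2 f)" using c by simp
  also have "\<dots> \<le> energy2 G u / l2 u"
    unfolding S using E pos c by (intro divide_right_mono) auto
  finally show ?thesis using that[OF f 1] by blast
qed

text \<open>Fixing a vertex \<open>v\<close> where the value 1 is attained leaves a product of
  compact sets, compact by Tychonoff; the union over \<open>v\<close> is finite.\<close>

lemma compact_unit_functions: "compact unit_functions"
proof -
  define K where "K v = (\<Pi>\<^sub>E x\<in>UNIV. if x = v then {1} else if x \<in> V - V0 then {0..1} else {0::real})"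
    for v
  have "compact (K v)" for v
  proof -
    have "compactin (product_topology (\<lambda>_. euclidean) UNIV) (K v)"
      unfolding K_def by (subst compactin_PiE) auto
    then show ?thesis by (simp add: euclidean_product_topology)
  qed
  then have "compact (\<Union>v\<in>V - V0. K v)" by (intro compact_UN) auto
  also have "(\<Union>v\<in>V - V0. K v) = unit_functions"
  proof (intro equalityI subsetI)
    fix f assume "f \<in> (\<Union>v\<in>V - V0. K v)"
    then obtain v where v: "v \<in> V - V0" and "f \<in> K v" by blast
    then have *: "f x \<in> (if x = v then {1} else if x \<in> V - V0 then {0..1} else {0})" for x
      unfolding K_def by (blast dest: PiE_mem)
    have "0 \<le> f x \<and> f x \<le> 1" "x \<notin> V - V0 \<longrightarrow> f x = 0" for x
      using *[of x] v by (auto split: if_splits)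
    moreover have "f v = 1" using *[of v] by simp
    ultimately show "f \<in> unit_functions" using v unfolding unit_functions_def by blast
  next
    fix f assume "f \<in> unit_functions"
    then show "f \<in> (\<Union>v\<in>V - V0. K v)"
      unfolding unit_functions_def K_def PiE_UNIV_domain by fastforce
  qed
  finally show ?thesis .
qed

lemma indicator_unit: "(\<lambda>x. if x \<in> V - V0 then 1 else 0) \<in> unit_functions"
  using V0_sub by (auto simp: unit_functions_def)

text \<open>The quotient is continuous on a compact set, and \<open>normalise\<close> extends
  minimality to all Dirichlet functions.\<close>

lemma minimiser:
  obtains f where "f \<in> unit_functions" and "lambda02 G V0 = energy2 G f / l2 f"
proof -
  have coord: "continuous_on unit_functions (\<lambda>f. f v)" for v :: 'a
    by (rule continuous_on_subset[OF continuous_on_product_coordinates]) simp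
  have "continuous_on unit_functions (energy2 G)" "continuous_on unit_functions l2"
    unfolding energy2_def[abs_def] l2_def[abs_def] by (intro continuous_intros coord)+
  moreover have "\<forall>f\<in>unit_functions. l2 f \<noteq> 0" using l2_pos by fastforce
  ultimately have "continuous_on unit_functions (\<lambda>f. energy2 G f / l2 f)"
    by (rule continuous_on_divide)
  then obtain f where f: "f \<in> unit_functions"
    and min: "\<And>g. g \<in> unit_functions \<Longrightarrow> energy2 G f / l2 f \<le> energy2 G g / l2 g"
    using continuous_attains_inf[OF compact_unit_functions] indicator_unit by blast
  have "energy2 G f / l2 f \<le> energy2 G u / l2 u" if u: "u \<in> dirichlet_functions G V0" for u
  proof -
    obtain g where "g \<in> unit_functions" "energy2 G g / l2 g \<le> energy2 G u / l2 u"
      using normalise[OF u] by blast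
    then show ?thesis using min order_trans by blast
  qed
  then have "(INF u\<in>dirichlet_functions G V0. energy2 G u / l2 u) = energy2 G f / l2 f"
    using unit_functions_dirichlet[OF f] by (intro cInf_eq_minimum) auto
  then show ?thesis using that[OF f] by (simp add: lambda02_def l2_def)
qed

lemma T2_ge:
  assumes g: "g \<in> unit_functions"
  shows "(l1 g)\<^sup>2 / energy2 G g \<le> T2 G V0"
proof -
  let ?M = "\<Sum>v\<in>V. m v"
  \<comment> \<open>The supremum is real-valued, so boundedness is needed. The bound combines
    \<open>l1 f \<le> ?M\<close> with the estimate of \<open>1 / energy2 G f\<close> by
    \<open>4 * l1 f\<close>.\<close>
  have "(l1 u)\<^sup>2 / energy2 G u \<le> ?M\<^sup>2 * (4 * ?M)" if u: "u \<in> dirichlet_functions G V0" for u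
  proof -
    obtain f where f: "f \<in> unit_functions"
      and uf: "(l1 u)\<^sup>2 / energy2 G u \<le> (l1 f)\<^sup>2 / energy2 G f"
      using normalise[OF u] by blast
    have "l1 f \<le> ?M"
      unfolding l1_def
    proof (rule sum_mono)
      fix v assume "v \<in> V"
      then have "f v * m v \<le> 1 * m v"
        using unit_functionsD[OF f, of v] m_pos[of v] by (intro mult_right_mono) auto
      then show "\<bar>f v\<bar> * m v \<le> m v" using unit_functionsD(1)[OF f, of v] by simp
    qed
    note pos = energy_pos[OF f] l2_pos[OF f] l1_ge_1[OF f]
    have "1 / energy2 G f \<le> 4 * l1 f - 3 * l2 f"
      using energy_mult_ge_1[OF f] pos by (simp add: field_simps)
    also have "\<dots> \<le> 4 * ?M" using \<open>l1 f \<le> ?M\<close> pos by simp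
    finally have "(l1 f)\<^sup>2 * (1 / energy2 G f) \<le> ?M\<^sup>2 * (4 * ?M)"
      using \<open>l1 f \<le> ?M\<close> pos by (intro mult_mono power_mono) auto
    then show ?thesis using uf by simp
  qed
  then have "bdd_above ((\<lambda>u. (l1 u)\<^sup>2 / energy2 G u) ` dirichlet_functions G V0)"
    by (intro bdd_aboveI2)
  then show ?thesis
    unfolding T2_def l1_def[symmetric]
    by (rule cSUP_upper[OF unit_functions_dirichlet[OF g]])
qed

section \<open>The inequality and the equality case\<close>

text \<open>For the indicator function of \<open>V - V0\<close> the energy is at most the
  \<open>l1\<close> norm, so its quotient is at least that norm.\<close>

lemma T2_ge_measure: "(\<Sum>v\<in>V - V0. m v) \<le> T2 G V0"
proof -
  define f :: "'a \<Rightarrow> real" where "f x = (if x \<in> V - V0 then 1 else 0)" for x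
  have f: "f \<in> unit_functions" using indicator_unit by (simp add: f_def[abs_def])
  have A: "l1 f = (\<Sum>v\<in>V - V0. m v)"
    unfolding l1_def by (rule sum.mono_neutral_cong_right) (auto simp: f_def)
  have "(\<Sum>v\<in>V. \<Sum>w\<in>V. b v w * \<bar>f v - f w\<bar>\<^sup>2) \<le> (\<Sum>v\<in>V. \<Sum>w\<in>V. b v w * (f v + f w))"
    by (intro sum_mono mult_left_mono) (auto simp: f_def b_nonneg)
  also have "\<dots> = 2 * l1 f"
    unfolding sum_edges_eq l1_def by (simp add: unit_functionsD(1)[OF f])
  finally have "energy2 G f \<le> l1 f" by (simp add: energy2_def)
  then have "l1 f * energy2 G f \<le> (l1 f)\<^sup>2"
    using l1_ge_1[OF f] by (simp add: power2_eq_square)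
  then have "l1 f \<le> (l1 f)\<^sup>2 / energy2 G f"
    using energy_pos[OF f] by (simp add: pos_le_divide_eq)
  then show ?thesis using T2_ge[OF f] A by linarith
qed

lemma T2_pos: "0 < T2 G V0"
proof -
  have "0 < (\<Sum>v\<in>V - V0. m v)" using V0_sub m_pos by (intro sum_pos) auto
  then show ?thesis using T2_ge_measure by linarith
qed

lemma product_cubed: "(T2 G V0 powr (2 / 3) * lambda02 G V0) ^ 3 = (T2 G V0)\<^sup>2 * lambda02 G V0 ^ 3"
proof -
  have "(T2 G V0 powr (2 / 3)) ^ 3 = T2 G V0 powr 2"
    using T2_pos by (simp add: powr_power)
  then show ?thesis using T2_pos by (simp add: power_mult_distrib)
qed

text \<open>The minimiser also serves as test function for \<open>T2\<close>; the cubed product is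
  then bounded below by the ratio of the two sides of \<open>nash\<close>.\<close>

lemma product_cubed_ge:
  assumes f: "f \<in> unit_functions" and lam: "lambda02 G V0 = energy2 G f / l2 f"
  shows "l1 f ^ 4 * energy2 G f / l2 f ^ 3 \<le> (T2 G V0)\<^sup>2 * lambda02 G V0 ^ 3"
proof -
  note pos = energy_pos[OF f] l2_pos[OF f] l1_ge_1[OF f]
  have "l1 f ^ 4 * energy2 G f / l2 f ^ 3 = ((l1 f)\<^sup>2 / energy2 G f)\<^sup>2 * lambda02 G V0 ^ 3"
    unfolding lam using pos
    by (simp add: field_simps power2_eq_square power3_eq_cube power4_eq_xxxx)
  also have "\<dots> \<le> (T2 G V0)\<^sup>2 * lambda02 G V0 ^ 3"
    unfolding lam using pos T2_ge[OF f] by (intro mult_right_mono power_mono) auto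
  finally show ?thesis .
qed

lemma product_ge_1: "1 \<le> T2 G V0 powr (2 / 3) * lambda02 G V0"
proof -
  obtain f where f: "f \<in> unit_functions" and lam: "lambda02 G V0 = energy2 G f / l2 f"
    by (rule minimiser)
  have "1 \<le> l1 f ^ 4 * energy2 G f / l2 f ^ 3"
    using nash(1)[OF f] l2_pos[OF f] by simp
  also have "\<dots> \<le> (T2 G V0 powr (2 / 3) * lambda02 G V0) ^ 3"
    using product_cubed_ge[OF f lam] by (simp add: product_cubed)
  finally have "1 ^ 3 \<le> (T2 G V0 powr (2 / 3) * lambda02 G V0) ^ 3" by simp
  then show ?thesis
    using lam energy_pos[OF f] l2_pos[OF f] by (subst (asm) power_mono_iff) auto
qed

text \<open>The difference of the norms is a sum of nonnegative terms
  \<open>(f w - (f w)\<^sup>2) * m w\<close>, with \<open>m\<close> positive.\<close>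

lemma indicator_if_l1_eq_l2:
  assumes f: "f \<in> unit_functions" and eq: "l1 f = l2 f" and v: "v \<in> V"
  shows "f v = 0 \<or> f v = 1"
proof -
  have nonneg: "0 \<le> (f w - (f w)\<^sup>2) * m w" if "w \<in> V" for w
    using unit_functionsD[OF f, of w] m_pos[OF that]
    by (intro mult_nonneg_nonneg) (auto simp: power2_eq_square mult_left_le)
  have "(\<Sum>w\<in>V. (f w - (f w)\<^sup>2) * m w) = 0"
    using eq by (simp add: l1_def l2_def left_diff_distrib sum_subtractf unit_functionsD[OF f])
  then have "(f v - (f v)\<^sup>2) * m v = 0" using nonneg v by (simp add: sum_nonneg_eq_0_iff)
  then show ?thesis using m_pos[OF v] by (auto simp: power2_eq_square)
qed

lemma equality_imp:
  assumes eq: "T2 G V0 powr (2 / 3) * lambda02 G V0 = 1"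
  shows "\<exists>v. V - V0 = {v} \<and> deg G v = 1"
proof -
  obtain f where f: "f \<in> unit_functions" and lam: "lambda02 G V0 = energy2 G f / l2 f"
    by (rule minimiser)
  note pos = energy_pos[OF f] l2_pos[OF f] l1_ge_1[OF f]
  have TL: "(T2 G V0)\<^sup>2 * lambda02 G V0 ^ 3 = 1" using product_cubed eq by simp
  have "l1 f ^ 4 * energy2 G f \<le> l2 f ^ 3"
    using product_cubed_ge[OF f lam] pos TL by simp
  then have nash_eq: "l2 f ^ 3 = l1 f ^ 4 * energy2 G f" using nash(1)[OF f] by simp
  then have AS: "l1 f = l2 f" by (rule nash(2)[OF f])
  have "l1 f ^ 3 * (l1 f * energy2 G f) = l1 f ^ 3 * 1"
    using nash_eq AS by (simp add: power3_eq_cube power4_eq_xxxx)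
  then have AE: "l1 f * energy2 G f = 1" using pos by simp
  \<comment> \<open>For values 0 and 1, absolute differences equal their squares, so the total
    variation is twice the energy.\<close>
  have "2 \<le> (\<Sum>v\<in>V. \<Sum>w\<in>V. b v w * \<bar>f v - f w\<bar>)"
    using unit_variation_ge[OF f, of "\<lambda>t. t"] by simp
  also have "\<dots> = (\<Sum>v\<in>V. \<Sum>w\<in>V. b v w * \<bar>f v - f w\<bar>\<^sup>2)"
  proof (intro sum.cong refl)
    fix v w assume "v \<in> V" "w \<in> V"
    then show "b v w * \<bar>f v - f w\<bar> = b v w * \<bar>f v - f w\<bar>\<^sup>2"
      using indicator_if_l1_eq_l2[OF f AS, of v] indicator_if_l1_eq_l2[OF f AS, of w] by auto
  qed
  finally have "1 \<le> energy2 G f" by (simp add: energy2_def)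
  then have "l1 f * 1 \<le> l1 f * energy2 G f" using pos by (intro mult_left_mono) auto
  then have "l1 f = 1" using AE pos by linarith
  then have "lambda02 G V0 = 1" using AE AS lam by simp
  then have "T2 G V0 = 1" using TL T2_pos by (simp add: power2_eq_1_iff)
  then have le1: "(\<Sum>v\<in>V - V0. m v) \<le> 1" using T2_ge_measure by simp
  \<comment> \<open>Every vertex has measure at least 1, so total measure at most 1 leaves a single
    vertex.\<close>
  have "real (card (V - V0)) \<le> (\<Sum>v\<in>V - V0. m v)"
    using sum_mono[of "V - V0" "\<lambda>_. 1" m] m_ge_1 by simp
  then have "card (V - V0) \<le> 1" using le1 by linarith
  moreover have "V - V0 \<noteq> {}" using V0_sub by auto
  ultimately have "card (V - V0) = 1" by (simp add: card_gt_0_iff le_antisym Suc_le_eq)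
  then obtain v where v: "V - V0 = {v}" by (auto simp: card_1_singleton_iff)
  then have "v \<in> V" by auto
  then have "m v = 1" using le1 v m_ge_1[of v] by simp
  then show ?thesis using v \<open>v \<in> V\<close> m_eq by (auto simp: deg_def)
qed

text \<open>A Dirichlet function is determined on \<open>V\<close> by \<open>u v\<close>, and both
  quotients are constantly 1.\<close>

lemma equality_if:
  assumes v: "V - V0 = {v}" and d: "deg G v = 1"
  shows "T2 G V0 powr (2 / 3) * lambda02 G V0 = 1"
proof -
  have vV: "v \<in> V" using v by auto
  have mv: "m v = 1" using m_eq[OF vV] d by (simp add: deg_def)
  have out: "u w = 0" if "u \<in> dirichlet_functions G V0" "w \<in> V - {v}" for u w
    using that v by (auto simp: dirichlet_functions_def)
  have nz: "u v \<noteq> 0" if u: "u \<in> dirichlet_functions G V0" for u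
    using that out[OF u] by (auto simp: dirichlet_functions_def)
  have A: "l1 u = \<bar>u v\<bar>" and S: "l2 u = (u v)\<^sup>2" and E: "energy2 G u = (u v)\<^sup>2"
    if u: "u \<in> dirichlet_functions G V0" for u
  proof -
    have point: "(\<Sum>w\<in>V. q w) = q v" if "\<And>w. w \<in> V - {v} \<Longrightarrow> q w = 0" for q :: "'a \<Rightarrow> real"
      using that vV by (simp add: sum.remove[of V v])
    show "l1 u = \<bar>u v\<bar>" unfolding l1_def by (subst point) (auto simp: out[OF u] mv)
    show S: "l2 u = (u v)\<^sup>2" unfolding l2_def by (subst point) (auto simp: out[OF u] mv)
    \<comment> \<open>The mixed term could survive only at \<open>x = y = v\<close>, where there is
      no loop.\<close>
    have "b x y * \<bar>u x - u y\<bar>\<^sup>2 = b x y * ((u x)\<^sup>2 + (u y)\<^sup>2)" if "x \<in> V" "y \<in> V" for x y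
      using that out[OF u, of x] out[OF u, of y] b_loop[OF vV]
      by (cases "x = v"; cases "y = v") auto
    then have "energy2 G u = 1 / 2 * (\<Sum>x\<in>V. \<Sum>y\<in>V. b x y * ((u x)\<^sup>2 + (u y)\<^sup>2))"
      unfolding energy2_def by (simp only: cong: sum.cong)
    also have "\<dots> = l2 u" by (simp only: sum_edges_eq l2_def power2_abs)
    finally show "energy2 G u = (u v)\<^sup>2" using S by simp
  qed
  have ne: "dirichlet_functions G V0 \<noteq> {}" using indicator_unit unit_functions_dirichlet by blast
  have "T2 G V0 = (SUP u\<in>dirichlet_functions G V0. 1)"
    unfolding T2_def l1_def[symmetric] using A E nz by (intro SUP_cong) auto
  moreover have "lambda02 G V0 = (INF u\<in>dirichlet_functions G V0. 1)"
    unfolding lambda02_def l2_def[symmetric] using S E nz by (intro INF_cong) auto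
  ultimately show ?thesis using ne by simp
qed

section \<open>The identified graph\<close>

text \<open>All edges at \<open>v\<close> end in \<open>V0\<close>; the sums are the weights of the
  edge between \<open>Some v\<close> and \<open>None\<close> after identification.\<close>

lemma deg_eq_sum_V0:
  assumes v: "V - V0 = {v}"
  shows "deg G v = (\<Sum>w\<in>V0. b v w)" "(\<Sum>w\<in>V0. b w v) = (\<Sum>w\<in>V0. b v w)"
proof -
  have V: "V = insert v V0" "v \<notin> V0" and vV: "v \<in> V" using v V0_sub by auto
  have "finite V0" using V0_sub finite_subset fin by blast
  then have "(\<Sum>w\<in>V. b v w) = b v v + (\<Sum>w\<in>V0. b v w)" using V by simp
  then show "deg G v = (\<Sum>w\<in>V0. b v w)" using b_loop[OF vV] by (simp add: deg_def)
  show "(\<Sum>w\<in>V0. b w v) = (\<Sum>w\<in>V0. b v w)"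
    using V0_sub vV by (intro sum.cong) (auto intro: b_sym)
qed

lemma single_edge_path_identify_iff:
  assumes "zero_potential G"
  shows "single_edge_path_one_dirichlet (identify G V0) {None}
    \<longleftrightarrow> (\<exists>v. V - V0 = {v} \<and> deg G v = 1)"
proof
  assume "single_edge_path_one_dirichlet (identify G V0) {None}"
  then obtain x y where xy: "x \<noteq> y" "verts (identify G V0) = {x, y}"
      "ewt (identify G V0) x y = 1" "{None} = {x}"
    unfolding single_edge_path_one_dirichlet_def by blast
  have "x = None" using xy(4) by simp
  then have y: "y \<noteq> None" "insert None (Some ` (V - V0)) = {None, y}"
      "identified_ewt G V0 None y = 1"
    using xy(1-3) by (auto simp: identify_def Let_def)
  then obtain v where yv: "y = Some v" by auto
  have "Some ` (V - V0) = Some ` {v}" using y(2) yv by (auto simp: set_eq_iff)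
  then have v: "V - V0 = {v}" by (simp only: inj_image_eq_iff inj_Some)
  then show "\<exists>v. V - V0 = {v} \<and> deg G v = 1" using deg_eq_sum_V0[OF v] y(3) yv by auto
next
  assume "\<exists>v. V - V0 = {v} \<and> deg G v = 1"
  then obtain v where v: "V - V0 = {v}" and d: "deg G v = 1" by blast
  have vV: "v \<in> V" using v by auto
  have pot: "pot G w = 0" if "w \<in> V" for w using assms that by (simp add: zero_potential_def)
  have pots: "(\<Sum>w\<in>V0. pot G w) = 0" using pot V0_sub by (intro sum.neutral) auto
  show "single_edge_path_one_dirichlet (identify G V0) {None}"
    unfolding single_edge_path_one_dirichlet_def
    using deg_eq_sum_V0[OF v] d v b_loop[OF vV] pot[OF vV] pots
    by (auto simp: identify_def Let_def finite_graph_def zero_potential_def degree_measure_def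
        deg_def intro!: exI[of _ "None"] exI[of _ "Some v"])
qed

end

theorem theorem5p19:
  fixes G :: "'a wgraph" and V0 :: "'a set"
  assumes "finite_graph G"
    and "connected_graph G"
    and "standard_edge_weights G"
    and "zero_potential G"
    and "degree_measure G"
    and "V0 \<noteq> {}" and "V0 \<subset> verts G"
  shows "T2 G V0 powr (2 / 3) * lambda02 G V0 \<ge> 1 \<and>
    (T2 G V0 powr (2 / 3) * lambda02 G V0 = 1 \<longleftrightarrow>
       single_edge_path_one_dirichlet (identify G V0) {None}) \<and>
    (T2 G V0 powr (2 / 3) * lambda02 G V0 = 1 \<longleftrightarrow>
       (\<exists>v. verts G - V0 = {v} \<and> deg G v = 1))"
proof -
  interpret dirichlet_graph G V0 by unfold_locales (fact assms)+
  show ?thesis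
    using product_ge_1 equality_imp equality_if single_edge_path_identify_iff[OF assms(4)] by blast
qed

end
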